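(* Let $(X,\mathcal{D})$ be a metric space of log-covering dimension $d$. Then the Lipschitz experts problem (with full feedback) on $(X,\mathcal{D})$ is $t^\gamma$-tractable for any $\gamma>\frac{d+1}{d+2}$.
   Context: Lipschitz experts problem on $(X,\mathcal{D})$ (diameter at most 1, known): an instance is an unknown Borel probability measure $\mathbb{P}$ on $[0,1]^X$ such that $\mu(x)=\mathbb{E}_{f\sim\mathbb{P}}[f(x)]$ is $1$-Lipschitz w.r.t. $\mathcal{D}$. Each round the algorithm picks $x_t$, $f_t\sim\mathbb{P}$ is drawn independently, the algorithm receives $f_t(x_t)$ and observes $f_t$ (may query it at any finite number of points). Regret $R(t)=t\sup\mu-\mathbb{E}[\sum_{s\le t}\mu(x_s)]$. $t^\gamma$-tractable: there is an algorithm such that for each instance there is a constant $C$ with $R(t)\le Ct^\gamma$ for all $t$. Log-covering dimension: $\mathrm{LCD}(X)=\limsup_{r\to0}\frac{\log\log N_r(X)}{\log(1/r)}$, where $N_r(X)$ is the smallest number of sets of diameter at most $r$ sufficient to cover $X$. *)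

theory Defs
  imports "HOL-Probability.Probability"
begin

definition covering_number :: "'a::metric_space set \<Rightarrow> real \<Rightarrow> enat" where
  "covering_number A r =
     (INF \<U> \<in> {\<U>. finite \<U> \<and> A \<subseteq> \<Union>\<U> \<and> (\<forall>U\<in>\<U>. bounded U \<and> diameter U \<le> r)}. enat (card \<U>))"

text \<open>If \<open>N = \<infinity>\<close> the iterated logarithm is \<open>\<infinity>\<close>. For \<open>N = 1\<close> the library value \<open>ln 0 = 0\<close>
  is used; this case persists as \<open>r \<rightarrow> 0\<close> only for a one-point space, which thus has
  log-covering dimension \<open>0\<close>.\<close>

definition log_log :: "enat \<Rightarrow> ereal" where
  "log_log N = (case N of enat n \<Rightarrow> ereal (ln (ln (real n))) | \<infinity> \<Rightarrow> \<infinity>)"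

definition log_covering_dim :: "'a::metric_space set \<Rightarrow> ereal" where
  "log_covering_dim A =
     Limsup (at_right 0) (\<lambda>r. log_log (covering_number A r) / ereal (ln (1 / r)))"

text \<open>The topology on the function type is the product topology, so the following is the Borel
  \<open>\<sigma>\<close>-algebra of \<open>[0,1]\<^sup>X\<close> (only its space and measurable sets matter).\<close>

definition payoff_space :: "('a \<Rightarrow> real) measure" where
  "payoff_space = restrict_space borel {f. \<forall>x. f x \<in> {0..1}}"

definition mean_payoff :: "('a \<Rightarrow> real) measure \<Rightarrow> 'a \<Rightarrow> real" where
  "mean_payoff P x = (\<integral>f. f x \<partial>P)"

definition lipschitz_instance :: "('a::metric_space \<Rightarrow> real) measure \<Rightarrow> bool" where
  "lipschitz_instance P \<longleftrightarrow>
     prob_space P \<and> sets P = sets payoff_space \<and> 1-lipschitz_on UNIV (mean_payoff P)"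

text \<open>An adaptive strategy for querying a payoff function. Since datatypes are well-founded, every
  run asks only finitely many queries, without a uniform bound on their number.\<close>

datatype 'a query_tree = Stop | Query 'a "real \<Rightarrow> 'a query_tree"

primrec answers :: "'a query_tree \<Rightarrow> ('a \<Rightarrow> real) \<Rightarrow> ('a \<times> real) list" where
  "answers Stop f = []"
| "answers (Query x k) f = (x, f x) # answers (k (f x)) f"

text \<open>Record of one round: the point picked, the payoff received, the queries with their answers.\<close>

type_synonym 'a round = "'a \<times> real \<times> ('a \<times> real) list"

text \<open>A randomized algorithm draws a random seed once, before the first round. Given the seed and
  the past rounds, \<open>pick\<close> is the next point; given in addition the payoff received for that
  point, \<open>query\<close> is the strategy for querying the current payoff function.\<close>

datatype 'a experts_algorithm = Experts_Algorithm
  (seed: "real measure")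
  (pick: "real \<Rightarrow> 'a round list \<Rightarrow> 'a")
  (query: "real \<Rightarrow> 'a round list \<Rightarrow> real \<Rightarrow> 'a query_tree")

text \<open>Rounds are numbered from \<open>0\<close>: the payoff function of round \<open>t\<close> is \<open>F t\<close>, and
  \<open>history A \<omega> F t\<close> lists the rounds before round \<open>t\<close>.\<close>

primrec history ::
  "'a experts_algorithm \<Rightarrow> real \<Rightarrow> (nat \<Rightarrow> 'a \<Rightarrow> real) \<Rightarrow> nat \<Rightarrow> 'a round list" where
  "history A \<omega> F 0 = []"
| "history A \<omega> F (Suc t) =
     (let h = history A \<omega> F t; x = pick A \<omega> h; y = F t x
      in h @ [(x, y, answers (query A \<omega> h y) (F t))])"

definition chosen ::
  "'a experts_algorithm \<Rightarrow> real \<Rightarrow> (nat \<Rightarrow> 'a \<Rightarrow> real) \<Rightarrow> nat \<Rightarrow> 'a" where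
  "chosen A \<omega> F t = pick A \<omega> (history A \<omega> F t)"

text \<open>The measurability condition makes every chosen point a random variable, for every instance.\<close>

definition valid_algorithm :: "'a::metric_space experts_algorithm \<Rightarrow> bool" where
  "valid_algorithm A \<longleftrightarrow>
     prob_space (seed A) \<and> sets (seed A) = sets borel \<and>
     (\<forall>t. (\<lambda>(\<omega>, F). chosen A \<omega> F t)
            \<in> borel_measurable (seed A \<Otimes>\<^sub>M (\<Pi>\<^sub>M s\<in>(UNIV::nat set). payoff_space)))"

definition regret :: "'a experts_algorithm \<Rightarrow> ('a \<Rightarrow> real) measure \<Rightarrow> nat \<Rightarrow> real" where
  "regret A P t =
     real t * (SUP x. mean_payoff P x)
     - (\<integral>(\<omega>, F). (\<Sum>s<t. mean_payoff P (chosen A \<omega> F s))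
          \<partial>(seed A \<Otimes>\<^sub>M (\<Pi>\<^sub>M s\<in>(UNIV::nat set). P)))"

definition experts_tractable :: "'a::metric_space itself \<Rightarrow> real \<Rightarrow> bool" where
  "experts_tractable _ \<gamma> \<longleftrightarrow>
     (\<exists>A::'a experts_algorithm. valid_algorithm A \<and>
        (\<forall>P. lipschitz_instance P \<longrightarrow> (\<exists>C. \<forall>t. regret A P t \<le> C * real t powr \<gamma>)))"

end

theory Submission
  imports Defs "HOL-Probability.Hoeffding" "HOL-Real_Asymp.Real_Asymp"
begin

text \<open>Decreasing \<open>\<gamma>\<close> if necessary, let \<open>\<gamma> < 1\<close>. In round \<open>t\<close> play the point with the best empirical
  payoff, over the rounds since \<open>t / 2\<close>, among a finite net at scale \<open>r = t powr (\<gamma> - 1)\<close>. Such a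
  net may be chosen with \<open>ln N \<le> r powr - b\<close>, where \<open>N\<close> is its size and \<open>b > d\<close>. By Hoeffding's
  lemma the empirical deviations of its points are sub-Gaussian; a bound on their expected maximum
  shows that the expected loss of the round is of order \<open>r + sqrt (ln N / t)\<close>. This is \<open>O(r)\<close> once
  \<open>r powr - (b + 2) \<le> t\<close>, which is possible precisely because \<open>(1 - \<gamma>) * (d + 2) < 1\<close>. Summing
  over the rounds gives \<open>O(t powr \<gamma>)\<close>.\<close>

section \<open>Finite nets and log-covering dimension\<close>

definition finite_net :: "real \<Rightarrow> 'a::metric_space set \<Rightarrow> 'a set \<Rightarrow> bool" where
  "finite_net r A S \<longleftrightarrow> finite S \<and> (\<forall>x\<in>A. \<exists>y\<in>S. dist x y \<le> r)"

lemma finite_cover_of_covering_number: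
  assumes "covering_number A r = enat N"
  obtains \<U> where "finite \<U>" "A \<subseteq> \<Union>\<U>" "\<And>U. U \<in> \<U> \<Longrightarrow> bounded U \<and> diameter U \<le> r"
    "card \<U> = N"
proof -
  let ?\<C> = "{\<U>. finite \<U> \<and> A \<subseteq> \<Union>\<U> \<and> (\<forall>U\<in>\<U>. bounded U \<and> diameter U \<le> r)}"
  have "?\<C> \<noteq> {}"
    using assms by (auto simp: covering_number_def Inf_enat_def split: if_splits)
  then obtain \<V> where "\<V> \<in> ?\<C>" by blast
  then have "covering_number A r \<in> (\<lambda>\<U>. enat (card \<U>)) ` ?\<C>"
    unfolding covering_number_def by (intro wellorder_InfI[OF imageI])
  then show thesis
    using that assms by auto
qed

lemma finite_net_of_covering_number:
  assumes "covering_number A r = enat N"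
  obtains S where "finite_net r A S" "card S \<le> N"
proof -
  obtain \<U> where \<U>: "finite \<U>" "A \<subseteq> \<Union>\<U>" "\<And>U. U \<in> \<U> \<Longrightarrow> bounded U \<and> diameter U \<le> r"
      "card \<U> = N"
    using finite_cover_of_covering_number[OF assms] by blast
  define center where "center = (\<lambda>U :: 'a set. SOME x. x \<in> U)"
  have "\<exists>y\<in>center ` \<U>. dist x y \<le> r" if "x \<in> A" for x
  proof -
    obtain U where U: "U \<in> \<U>" "x \<in> U" using \<U>(2) \<open>x \<in> A\<close> by blast
    then have "center U \<in> U" by (auto simp: center_def intro: someI)
    then have "dist x (center U) \<le> diameter U"
      using U \<U>(3) by (auto intro: diameter_bounded_bound)
    also have "\<dots> \<le> r" using U \<U>(3) by blast
    finally show ?thesis using U by auto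
  qed
  then have "finite_net r A (center ` \<U>)"
    using \<U>(1) by (auto simp: finite_net_def)
  moreover have "card (center ` \<U>) \<le> N"
    using card_image_le[OF \<U>(1)] \<U>(4) by blast
  ultimately show thesis by (rule that)
qed

lemma log_log_ge: "ereal (ln (ln 2)) \<le> log_log N"
proof (cases N)
  case (enat n)
  have "ln (ln 2) \<le> ln (ln (real n))"
  proof (cases "n \<ge> 2")
    case False
    then have "n = 0 \<or> n = 1" by linarith
    then show ?thesis using ln_2_less_1 by auto
  qed simp
  then show ?thesis by (simp add: log_log_def enat)
qed (simp add: log_log_def)

lemma log_covering_dim_nonneg: "0 \<le> log_covering_dim A"
proof -
  have "((\<lambda>r::real. ereal (ln (ln 2) / ln (1 / r))) \<longlongrightarrow> ereal 0) (at_right 0)"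
    by (intro tendsto_ereal) real_asymp
  from lim_imp_Limsup[OF _ this]
  have "0 = Limsup (at_right 0) (\<lambda>r::real. ereal (ln (ln 2) / ln (1 / r)))"
    by (simp add: zero_ereal_def)
  also have "\<dots> \<le> log_covering_dim A"
    unfolding log_covering_dim_def
  proof (rule Limsup_mono)
    show "\<forall>\<^sub>F r in at_right 0. ereal (ln (ln 2) / ln (1 / r))
        \<le> log_log (covering_number A r) / ereal (ln (1 / r))"
      using eventually_at_right_real[OF zero_less_one]
    proof eventually_elim
      case (elim r)
      then have "ln (1 / r) > 0" by (simp add: ln_div)
      with log_log_ge[of "covering_number A r"] show ?case
        using ereal_divide_right_mono[of "ereal (ln (ln 2))" _ "ereal (ln (1 / r))"] by simp
    qed
  qed
  finally show ?thesis .
qed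

lemma ln_le_powr_if_ln_ln_less:
  fixes b r :: real and n :: nat
  assumes "0 < r" "r < 1" "ln (ln n) / ln (1 / r) < b"
  shows "ln n \<le> r powr - b"
proof (cases "n \<ge> 2")
  case True
  have "ln (1 / r) > 0" using assms(1,2) by (simp add: ln_div)
  with assms(3) have "ln (ln n) \<le> b * ln (1 / r)"
    by (simp add: pos_divide_less_eq less_imp_le)
  then have "exp (ln (ln n)) \<le> exp (b * ln (1 / r))" by simp
  also have "exp (b * ln (1 / r)) = r powr - b"
    using assms(1) by (simp add: powr_def ln_div)
  finally show ?thesis using True by simp
next
  case False
  then have "n = 0 \<or> n = 1" by linarith
  then show ?thesis by auto
qed

lemma eventually_finite_net_of_log_covering_dim:
  assumes "log_covering_dim A < ereal b"
  shows "\<forall>\<^sub>F r in at_right 0. \<exists>S. finite_net r A S \<and> ln (card S) \<le> r powr - b"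
  using Limsup_lessD[OF assms[unfolded log_covering_dim_def]]
    eventually_at_right_real[OF zero_less_one]
proof eventually_elim
  case (elim r)
  then have "ln (1 / r) > 0" by (simp add: ln_div)
  with elim obtain N where N: "covering_number A r = enat N"
    by (cases "covering_number A r") (auto simp: log_log_def)
  then obtain S where S: "finite_net r A S" "card S \<le> N"
    using finite_net_of_covering_number by blast
  have "ln (card S) \<le> ln N"
  proof (cases "card S = 0")
    case False
    with S(2) show ?thesis by simp
  qed (cases N, auto)
  also have "\<dots> \<le> r powr - b"
    using elim N by (intro ln_le_powr_if_ln_ln_less) (auto simp: log_log_def)
  finally show ?case using S(1) by blast
qed

text \<open>The resolution \<open>r\<close> is at least the error \<open>sqrt (ln (card S) / n)\<close> made in comparing the points
  of \<open>S\<close> on \<open>n\<close> samples.\<close>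

definition balanced_net :: "real \<Rightarrow> real \<Rightarrow> 'a::metric_space set \<Rightarrow> 'a set \<Rightarrow> bool" where
  "balanced_net n r A S \<longleftrightarrow> finite_net r A S \<and> ln (card S) \<le> n * r\<^sup>2"

lemma eventually_balanced_net_list:
  assumes "\<forall>\<^sub>F s in F. \<exists>S. balanced_net (n s) (r s) A S"
  obtains net where "\<forall>\<^sub>F s in F. balanced_net (n s) (r s) A (set (net s))"
proof -
  have "\<forall>\<^sub>F s in F. \<exists>xs. balanced_net (n s) (r s) A (set xs)"
    using assms
  proof eventually_elim
    case (elim s)
    then obtain S where S: "balanced_net (n s) (r s) A S" by blast
    then have "finite S" by (simp add: balanced_net_def finite_net_def)
    then obtain xs where "set xs = S" using finite_list by blast
    with S show ?case by blast
  qed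
  then have "\<forall>\<^sub>F s in F.
      balanced_net (n s) (r s) A (set (SOME xs. balanced_net (n s) (r s) A (set xs)))"
    by eventually_elim (rule someI_ex)
  then show thesis by (rule that)
qed

lemma eventually_balanced_net_of_log_covering_dim:
  fixes A :: "'a::metric_space set" and p :: real
  assumes dim: "log_covering_dim A = ereal d" and p: "(d + 1) / (d + 2) < p" "p < 1"
  shows "\<forall>\<^sub>F s in sequentially. \<exists>S. balanced_net (real s + 1) ((real s + 1) powr (p - 1)) A S"
proof -
  define r where "r = (\<lambda>s. (real s + 1) powr (p - 1))"
  define b where "b = 1 / (1 - p) - 2"
  have "d \<ge> 0" using log_covering_dim_nonneg[of A] dim by simp
  then have "d < b"
    using p by (simp add: b_def field_simps)
  have r_powr: "r s powr - b = (real s + 1) * (r s)\<^sup>2" for s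
  proof -
    have "(1 - p) * (b + 2) = 1" using p(2) by (simp add: b_def)
    then have "(p - 1) * - b = 1 + (p - 1) + (p - 1)" by (simp add: algebra_simps)
    then have "r s powr - b = (real s + 1) powr (1 + (p - 1) + (p - 1))"
      by (simp only: r_def powr_powr)
    also have "\<dots> = (real s + 1) * (r s)\<^sup>2"
      unfolding powr_add r_def by (simp add: power2_eq_square)
    finally show ?thesis .
  qed
  have "\<forall>\<^sub>F \<rho> in at_right 0. \<exists>S. finite_net \<rho> A S \<and> ln (card S) \<le> \<rho> powr - b"
    using dim \<open>d < b\<close> by (intro eventually_finite_net_of_log_covering_dim) simp
  moreover have "filterlim r (at_right 0) sequentially"
    unfolding r_def using p(2) by real_asymp
  ultimately have "\<forall>\<^sub>F s in sequentially. \<exists>S. finite_net (r s) A S \<and> ln (card S) \<le> r s powr - b"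
    by (rule eventually_compose_filterlim)
  then show ?thesis unfolding balanced_net_def r_powr unfolding r_def .
qed

section \<open>Expected maxima of sub-Gaussian variables\<close>

lemma le_2_sqrt_if_le_divide_add_mult:
  fixes y A B :: real
  assumes "A \<ge> 0" "B > 0" and bound: "\<And>l. l > 0 \<Longrightarrow> y \<le> A / l + B * l"
  shows "y \<le> 2 * sqrt (A * B)"
proof (cases "A = 0")
  case True
  have "y \<le> 0 + e" if "e > 0" for e
    using bound[of "e / B"] True \<open>B > 0\<close> that by simp
  then have "y \<le> 0" by (rule field_le_epsilon)
  with True show ?thesis by simp
next
  case False
  with assms have pos: "A > 0" "B > 0" by auto
  define l where "l = sqrt (A / B)"
  have "l > 0" using pos by (simp add: l_def)
  have "B * l = sqrt (A * B)"
    using pos by (simp add: l_def real_sqrt_divide real_sqrt_mult field_simps)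
  moreover have "A / l = sqrt (A * B)"
    using pos by (simp add: l_def real_sqrt_divide real_sqrt_mult field_simps)
  ultimately show ?thesis using bound[OF \<open>l > 0\<close>] by simp
qed

lemma exp_Max_le_sum_exp:
  fixes l :: real and g :: "'a \<Rightarrow> real"
  assumes "finite S" "S \<noteq> {}"
  shows "exp (l * Max (g ` S)) \<le> (\<Sum>x\<in>S. exp (l * g x))"
proof -
  have "Max (g ` S) \<in> g ` S"
    using assms by (intro Max_in) auto
  then obtain x where x: "x \<in> S" "Max (g ` S) = g x" by auto
  have "exp (l * g x) \<le> (\<Sum>x\<in>S. exp (l * g x))"
    by (rule member_le_sum[OF x(1) _ assms(1)]) simp
  with x(2) show ?thesis by simp
qed

context prob_space
begin

lemma integrable_Max:
  fixes D :: "'b \<Rightarrow> 'a \<Rightarrow> real"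
  assumes "finite S" "S \<noteq> {}" "\<And>x. x \<in> S \<Longrightarrow> integrable M (D x)"
  shows "integrable M (\<lambda>\<omega>. Max ((\<lambda>x. D x \<omega>) ` S))"
  using assms by (induction S rule: finite_ne_induct) auto

lemma expectation_Max_le:
  fixes D :: "'b \<Rightarrow> 'a \<Rightarrow> real"
  assumes S: "finite S" "S \<noteq> {}" and "l > 0"
    and int: "\<And>x. x \<in> S \<Longrightarrow> integrable M (D x)"
    and exp_int: "\<And>x. x \<in> S \<Longrightarrow> integrable M (\<lambda>\<omega>. exp (l * D x \<omega>))"
    and mgf: "\<And>x. x \<in> S \<Longrightarrow> expectation (\<lambda>\<omega>. exp (l * D x \<omega>)) \<le> exp K"
  shows "expectation (\<lambda>\<omega>. Max ((\<lambda>x. D x \<omega>) ` S)) \<le> (ln (card S) + K) / l"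
proof -
  define Z where "Z = (\<lambda>\<omega>. Max ((\<lambda>x. D x \<omega>) ` S))"
  have Z_int: "integrable M Z"
    unfolding Z_def by (rule integrable_Max[OF S int])
  have sum_int: "integrable M (\<lambda>\<omega>. \<Sum>x\<in>S. exp (l * D x \<omega>))"
    using exp_int by simp
  have exp_Z: "exp (l * Z \<omega>) \<le> (\<Sum>x\<in>S. exp (l * D x \<omega>))" for \<omega>
    unfolding Z_def by (rule exp_Max_le_sum_exp[OF S])
  have exp_Z_int: "integrable M (\<lambda>\<omega>. exp (l * Z \<omega>))"
    using sum_int
  proof (rule Bochner_Integration.integrable_bound)
    show "(\<lambda>\<omega>. exp (l * Z \<omega>)) \<in> borel_measurable M" using Z_int by measurable
  qed (use exp_Z in \<open>auto simp: sum_nonneg\<close>)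
  have "exp (l * expectation Z) \<le> expectation (\<lambda>\<omega>. exp (l * Z \<omega>))"
    using \<open>l > 0\<close> by (intro jensens_inequality[where I = UNIV and q = "\<lambda>x. exp (l * x)"]
        Z_int exp_Z_int convex_on_exp) auto
  also have "\<dots> \<le> expectation (\<lambda>\<omega>. \<Sum>x\<in>S. exp (l * D x \<omega>))"
    by (rule integral_mono[OF exp_Z_int sum_int exp_Z])
  also have "\<dots> = (\<Sum>x\<in>S. expectation (\<lambda>\<omega>. exp (l * D x \<omega>)))"
    using exp_int by (intro Bochner_Integration.integral_sum)
  also have "\<dots> \<le> card S * exp K"
    using sum_mono[of S _ "\<lambda>_. exp K", OF mgf] by simp
  also have "\<dots> = exp (ln (card S) + K)"
    using S by (simp add: exp_add card_gt_0_iff)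
  finally show ?thesis
    using \<open>l > 0\<close> by (simp add: Z_def field_simps)
qed

lemma expectation_Max_subgaussian_le:
  fixes D :: "'b \<Rightarrow> 'a \<Rightarrow> real"
  assumes S: "finite S" "S \<noteq> {}" and "v > 0"
    and int: "\<And>x. x \<in> S \<Longrightarrow> integrable M (D x)"
    and exp_int: "\<And>x l. x \<in> S \<Longrightarrow> l > 0 \<Longrightarrow> integrable M (\<lambda>\<omega>. exp (l * D x \<omega>))"
    and mgf: "\<And>x l. x \<in> S \<Longrightarrow> l > 0 \<Longrightarrow>
      expectation (\<lambda>\<omega>. exp (l * D x \<omega>)) \<le> exp (l\<^sup>2 * v / 2)"
  shows "expectation (\<lambda>\<omega>. Max ((\<lambda>x. D x \<omega>) ` S)) \<le> sqrt (2 * v * ln (card S))"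
proof -
  let ?E = "expectation (\<lambda>\<omega>. Max ((\<lambda>x. D x \<omega>) ` S))"
  have "?E \<le> ln (card S) / l + v / 2 * l" if "l > 0" for l
  proof -
    have "?E \<le> (ln (card S) + l\<^sup>2 * v / 2) / l"
      using S that int exp_int mgf by (intro expectation_Max_le)
    also have "\<dots> = ln (card S) / l + v / 2 * l"
      using that by (simp add: field_simps power2_eq_square)
    finally show ?thesis .
  qed
  then have "?E \<le> 2 * sqrt (ln (card S) * (v / 2))"
    using S \<open>v > 0\<close> by (intro le_2_sqrt_if_le_divide_add_mult) (auto simp: Suc_le_eq card_gt_0_iff)
  also have "\<dots> = sqrt (2\<^sup>2 * (ln (card S) * (v / 2)))"
    by (simp only: real_sqrt_mult real_sqrt_abs)
  also have "\<dots> = sqrt (2 * v * ln (card S))" by (simp add: mult_ac)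
  finally show ?thesis .
qed

end

section \<open>Sums of independent bounded variables\<close>

lemma (in interval_bounded_random_variable) integrable_exp_deviation:
  assumes "l \<ge> 0"
  shows "integrable M (\<lambda>\<omega>. exp (l * (f \<omega> - c)))"
proof (rule integrable_const_bound)
  show "AE \<omega> in M. norm (exp (l * (f \<omega> - c))) \<le> exp (l * (b - c))"
    using AE_in_interval by eventually_elim (use assms in \<open>auto intro: mult_left_mono\<close>)
qed measurable

lemma (in interval_bounded_random_variable) expectation_exp_deviation_le:
  assumes "l > 0"
  shows "expectation (\<lambda>\<omega>. exp (l * (f \<omega> - expectation f))) \<le> exp (l\<^sup>2 * (b - a)\<^sup>2 / 8)"
  using Hoeffdings_lemma_nn_integral[OF assms] integrable_exp_deviation[of l "expectation f"] assms
  by (simp add: nn_integral_eq_integral)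

context indep_interval_bounded_random_variables
begin

lemma indep_exp_deviation:
  "indep_vars (\<lambda>_. borel) (\<lambda>i \<omega>. exp (l * (X i \<omega> - expectation (X i)))) I"
  by (rule indep_vars_compose2[OF indep, where Y = "\<lambda>i x. exp (l * (x - expectation (X i)))"])
    measurable

lemma exp_sum_deviation:
  "exp (l * (\<Sum>i\<in>I. X i \<omega> - expectation (X i))) = (\<Prod>i\<in>I. exp (l * (X i \<omega> - expectation (X i))))"
  using fin by (simp add: sum_distrib_left exp_sum)

lemma integrable_exp_sum_deviation:
  assumes "l \<ge> 0"
  shows "integrable M (\<lambda>\<omega>. exp (l * (\<Sum>i\<in>I. X i \<omega> - expectation (X i))))"
  unfolding exp_sum_deviation
  using assms bounded_random_variable
  by (intro indep_vars_integrable fin indep_exp_deviation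
      interval_bounded_random_variable.integrable_exp_deviation) auto

lemma expectation_exp_sum_deviation_le:
  assumes "l > 0"
  shows "expectation (\<lambda>\<omega>. exp (l * (\<Sum>i\<in>I. X i \<omega> - expectation (X i))))
    \<le> exp (l\<^sup>2 * (\<Sum>i\<in>I. (b i - a i)\<^sup>2) / 8)"
proof -
  have "expectation (\<lambda>\<omega>. exp (l * (\<Sum>i\<in>I. X i \<omega> - expectation (X i))))
      = (\<Prod>i\<in>I. expectation (\<lambda>\<omega>. exp (l * (X i \<omega> - expectation (X i)))))"
    unfolding exp_sum_deviation
    using assms by (intro indep_vars_lebesgue_integral fin indep_exp_deviation
        interval_bounded_random_variable.integrable_exp_deviation bounded_random_variable) auto
  also have "\<dots> \<le> (\<Prod>i\<in>I. exp (l\<^sup>2 * (b i - a i)\<^sup>2 / 8))"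
    using assms by (intro prod_mono conjI integral_nonneg_AE
        interval_bounded_random_variable.expectation_exp_deviation_le bounded_random_variable) auto
  also have "\<dots> = exp (l\<^sup>2 * (\<Sum>i\<in>I. (b i - a i)\<^sup>2) / 8)"
    using fin by (simp add: exp_sum sum_distrib_left sum_divide_distrib)
  finally show ?thesis .
qed

end

lemma indep_vars_PiM_component:
  assumes "\<And>i. i \<in> I \<Longrightarrow> prob_space (M i)"
  shows "prob_space.indep_vars (\<Pi>\<^sub>M i\<in>I. M i) M (\<lambda>i F. F i) I"
proof -
  interpret prob_space "\<Pi>\<^sub>M i\<in>I. M i" using assms by (rule prob_space_PiM)
  show ?thesis
  proof (cases "I = {}")
    case True
    then show ?thesis unfolding indep_vars_def indep_sets_def by simp
  next
    case False
    have "distr (\<Pi>\<^sub>M i\<in>I. M i) (\<Pi>\<^sub>M i\<in>I. M i) (\<lambda>F. \<lambda>i\<in>I. F i) = (\<Pi>\<^sub>M i\<in>I. M i)"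
      by (subst distr_cong[where g = "\<lambda>F. F"]) (auto simp: space_PiM)
    also have "\<dots> = (\<Pi>\<^sub>M i\<in>I. distr (\<Pi>\<^sub>M i\<in>I. M i) (M i) (\<lambda>F. F i))"
      using assms by (intro PiM_cong distr_PiM_component[symmetric]) auto
    finally show ?thesis
      using False by (subst indep_vars_iff_distr_eq_PiM') auto
  qed
qed

section \<open>Maximizers of finitely many random variables\<close>

lemma arg_max_on_cong:
  assumes "\<And>x. x \<in> S \<Longrightarrow> f x = g x"
  shows "arg_max_on f S = arg_max_on g S"
proof -
  have "is_arg_max f (\<lambda>x. x \<in> S) = is_arg_max g (\<lambda>x. x \<in> S)"
    using assms by (auto simp: is_arg_max_def fun_eq_iff)
  then show ?thesis by (simp add: arg_max_on_def arg_max_def)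
qed

lemma arg_max_on_eq_arg_min_on:
  fixes f :: "'a \<Rightarrow> 'b::linordered_ab_group_add"
  shows "arg_max_on f S = arg_min_on (\<lambda>x. - f x) S"
  by (simp add: arg_max_on_def arg_max_def is_arg_max_def
      arg_min_on_def arg_min_def is_arg_min_def)

lemma arg_max_on_in:
  fixes f :: "'a \<Rightarrow> 'b::linordered_ab_group_add"
  assumes "finite S" "S \<noteq> {}"
  shows "arg_max_on f S \<in> S"
  unfolding arg_max_on_eq_arg_min_on by (rule arg_min_if_finite(1)[OF assms])

lemma arg_max_on_greatest:
  fixes f :: "'a \<Rightarrow> 'b::linordered_ab_group_add"
  assumes "finite S" "y \<in> S"
  shows "f y \<le> f (arg_max_on f S)"
  using arg_min_least[of S y "\<lambda>x. - f x"] assms by (auto simp: arg_max_on_eq_arg_min_on)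

lemma gap_arg_max_on_le:
  fixes f g :: "'a \<Rightarrow> 'b::linordered_ab_group_add"
  assumes "finite S" "y \<in> S"
  shows "f y - f (arg_max_on g S) \<le> Max ((\<lambda>x. g x - f x) ` S) - (g y - f y)"
proof -
  let ?z = "arg_max_on g S"
  have "f y - f ?z \<le> (g ?z - f ?z) - (g y - f y)"
    using arg_max_on_greatest[OF assms, of g] by (simp add: algebra_simps)
  also have "g ?z - f ?z \<le> Max ((\<lambda>x. g x - f x) ` S)"
    using assms arg_max_on_in[of S g] by (intro Max_ge) auto
  finally show ?thesis by (simp add: diff_right_mono)
qed

lemma measurable_arg_max_on:
  fixes g :: "'a \<Rightarrow> 'b \<Rightarrow> 'c::{second_countable_topology, linorder_topology}"
  assumes "finite S" and [measurable]: "\<And>x. x \<in> S \<Longrightarrow> g x \<in> borel_measurable M"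
  shows "(\<lambda>\<omega>. arg_max_on (\<lambda>x. g x \<omega>) S) \<in> measurable M (count_space UNIV)"
proof -
  let ?A = "\<lambda>\<omega>. {x \<in> S. \<forall>y\<in>S. g y \<omega> \<le> g x \<omega>}"
  have "?A -` {T} \<inter> space M \<in> sets M" if "T \<subseteq> S" for T
  proof -
    have "?A -` {T} \<inter> space M = {\<omega> \<in> space M. \<forall>x\<in>S. x \<in> T \<longleftrightarrow> (\<forall>y\<in>S. g y \<omega> \<le> g x \<omega>)}"
      using that by blast
    also have "\<dots> \<in> sets M" using \<open>finite S\<close> by measurable
    finally show ?thesis .
  qed
  then have "?A \<in> measurable M (count_space (Pow S))"
    using \<open>finite S\<close> by (subst measurable_count_space_eq2) auto
  then have "(\<lambda>\<omega>. SOME x. x \<in> ?A \<omega>) \<in> measurable M (count_space UNIV)"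
    by (rule measurable_compose) simp
  then show ?thesis
    by (simp add: arg_max_on_def arg_max_def is_arg_max_linorder Ball_def)
qed

section \<open>Empirical leaders of random payoffs\<close>

abbreviation payoff_sequences :: "('a \<Rightarrow> real) measure \<Rightarrow> (nat \<Rightarrow> 'a \<Rightarrow> real) measure" where
  "payoff_sequences P \<equiv> \<Pi>\<^sub>M s\<in>(UNIV :: nat set). P"

definition empirical_leader :: "nat set \<Rightarrow> 'a set \<Rightarrow> (nat \<Rightarrow> 'a \<Rightarrow> real) \<Rightarrow> 'a" where
  "empirical_leader W S F = arg_max_on (\<lambda>x. \<Sum>s\<in>W. F s x) S"

lemma measurable_payoff_eval [measurable]: "(\<lambda>f. f x) \<in> borel_measurable payoff_space"
  unfolding payoff_space_def
  by (intro measurable_restrict_space1 borel_measurable_continuous_onI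
      continuous_on_product_coordinates)

lemma measurable_empirical_leader:
  assumes "finite S" "\<And>s x. s \<in> W \<Longrightarrow> x \<in> S \<Longrightarrow> (\<lambda>\<omega>. F \<omega> s x) \<in> borel_measurable M"
  shows "(\<lambda>\<omega>. empirical_leader W S (F \<omega>)) \<in> measurable M (count_space UNIV)"
  unfolding empirical_leader_def
  using assms by (intro measurable_arg_max_on borel_measurable_sum)

locale payoff_distribution = prob_space P for P :: "('a \<Rightarrow> real) measure" +
  assumes sets_eq_payoff_space [measurable_cong]: "sets P = sets payoff_space"
begin

lemma space_payoff_distribution: "space P = {f. \<forall>x. f x \<in> {0..1}}"
  using sets_eq_imp_space_eq[OF sets_eq_payoff_space]
  by (simp add: payoff_space_def space_restrict_space)

sublocale payoff: interval_bounded_random_variable P "\<lambda>f. f x" 0 1 for x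
  by unfold_locales (auto simp: space_payoff_distribution)

sublocale samples: prob_space "payoff_sequences P"
  by (intro prob_space_PiM prob_space_axioms)

lemma mean_payoff_bounds: "0 \<le> mean_payoff P x" "mean_payoff P x \<le> 1"
  unfolding mean_payoff_def
  by (auto simp: space_payoff_distribution intro!: integral_nonneg_AE
      integral_le_const[OF payoff.integrable])

lemma indep_bounded_samples:
  assumes "finite W"
  shows "indep_interval_bounded_random_variables (payoff_sequences P) W
    (\<lambda>s F. F s x) (\<lambda>_. 0) (\<lambda>_. 1)"
proof unfold_locales
  have "samples.indep_vars (\<lambda>_. P) (\<lambda>s F. F s) W"
    by (rule samples.indep_vars_subset[OF indep_vars_PiM_component])
      (auto intro: prob_space_axioms)
  then show "samples.indep_vars (\<lambda>_. borel) (\<lambda>s F. F s x) W"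
    by (rule samples.indep_vars_compose2) measurable
  show "AE F in payoff_sequences P. F s x \<in> {0..1}" for s
    by (rule AE_PiM_component) (auto intro: prob_space_axioms simp: space_payoff_distribution)
qed fact

lemma integrable_sample: "integrable (payoff_sequences P) (\<lambda>F. F s x)"
proof -
  interpret indep_interval_bounded_random_variables
      "payoff_sequences P" "{s}" "\<lambda>s F. F s x" "\<lambda>_. 0" "\<lambda>_. 1"
    by (rule indep_bounded_samples) simp
  show ?thesis
    using bounded_random_variable by (rule interval_bounded_random_variable.integrable) simp
qed

lemma expectation_sample: "samples.expectation (\<lambda>F. F s x) = mean_payoff P x"
proof -
  have "mean_payoff P x = (\<integral>f. f x \<partial>distr (payoff_sequences P) P (\<lambda>F. F s))"
    by (subst distr_PiM_component) (simp_all add: mean_payoff_def prob_space_axioms)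
  also have "\<dots> = samples.expectation (\<lambda>F. F s x)"
    by (rule integral_distr) measurable
  finally show ?thesis ..
qed

definition deviation :: "nat set \<Rightarrow> (nat \<Rightarrow> 'a \<Rightarrow> real) \<Rightarrow> 'a \<Rightarrow> real" where
  "deviation W F x = (\<Sum>s\<in>W. F s x - mean_payoff P x)"

lemma integrable_deviation: "integrable (payoff_sequences P) (\<lambda>F. deviation W F x)"
  unfolding deviation_def by (simp add: integrable_sample)

lemma expectation_deviation: "samples.expectation (\<lambda>F. deviation W F x) = 0"
  unfolding deviation_def
  by (simp add: integrable_sample expectation_sample samples.prob_space)

lemma expectation_Max_deviation_le:
  assumes "finite W" "W \<noteq> {}" "finite S" "S \<noteq> {}"
  shows "samples.expectation (\<lambda>F. Max (deviation W F ` S)) \<le> sqrt (card W * ln (card S) / 2)"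
proof -
  interpret indep_interval_bounded_random_variables
      "payoff_sequences P" W "\<lambda>s F. F s x" "\<lambda>_. 0" "\<lambda>_. 1" for x
    by (rule indep_bounded_samples) fact
  have "samples.expectation (\<lambda>F. Max (deviation W F ` S)) \<le> sqrt (2 * (card W / 4) * ln (card S))"
  proof (rule samples.expectation_Max_subgaussian_le[OF assms(3,4)])
    show "real (card W) / 4 > 0" using assms by (simp add: card_gt_0_iff)
    show "integrable (payoff_sequences P) (\<lambda>F. exp (l * deviation W F x))"
      if "l > 0" for x l
      using integrable_exp_sum_deviation[of l x] that
      by (simp add: deviation_def expectation_sample)
    show "samples.expectation (\<lambda>F. exp (l * deviation W F x)) \<le> exp (l\<^sup>2 * (card W / 4) / 2)"
      if "l > 0" for x l
      using expectation_exp_sum_deviation_le[of l x] that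
      by (simp add: deviation_def expectation_sample)
  qed (rule integrable_deviation)
  then show ?thesis by simp
qed

lemma integrable_mean_payoff_leader:
  assumes "finite S"
  shows "integrable (payoff_sequences P) (\<lambda>F. mean_payoff P (empirical_leader W S F))"
proof (rule samples.integrable_const_bound[where B = 1])
  have "(\<lambda>F. empirical_leader W S F) \<in> measurable (payoff_sequences P) (count_space UNIV)"
    using assms by (rule measurable_empirical_leader) measurable
  then show "(\<lambda>F. mean_payoff P (empirical_leader W S F))
      \<in> borel_measurable (payoff_sequences P)"
    by (rule measurable_compose) simp
qed (use mean_payoff_bounds in simp)

lemma expected_gap_empirical_leader_le:
  assumes W: "finite W" "W \<noteq> {}" and S: "finite S" "y \<in> S"
  shows "mean_payoff P y - samples.expectation (\<lambda>F. mean_payoff P (empirical_leader W S F))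
    \<le> sqrt (ln (card S) / (2 * card W))"
proof -
  let ?z = "empirical_leader W S"
  let ?n = "real (card W)"
  have n: "?n > 0" using W by (simp add: card_gt_0_iff)
  have deviation_eq: "deviation W F x = (\<Sum>s\<in>W. F s x) - ?n * mean_payoff P x" for F x
    by (simp add: deviation_def sum_subtractf)
  have "?n * (mean_payoff P y - mean_payoff P (?z F)) \<le> Max (deviation W F ` S) - deviation W F y"
    for F
    using gap_arg_max_on_le[OF S, of "\<lambda>x. ?n * mean_payoff P x" "\<lambda>x. \<Sum>s\<in>W. F s x"]
    by (simp add: deviation_eq empirical_leader_def right_diff_distrib)
  then have "samples.expectation (\<lambda>F. ?n * (mean_payoff P y - mean_payoff P (?z F)))
      \<le> samples.expectation (\<lambda>F. Max (deviation W F ` S) - deviation W F y)"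
    using S by (intro integral_mono Bochner_Integration.integrable_diff integrable_mult_right
        integrable_mean_payoff_leader samples.integrable_Max integrable_deviation) auto
  also have "\<dots> = samples.expectation (\<lambda>F. Max (deviation W F ` S))"
    using S by (subst Bochner_Integration.integral_diff)
      (auto intro: samples.integrable_Max integrable_deviation simp: expectation_deviation)
  also have "\<dots> \<le> sqrt (?n * ln (card S) / 2)"
    using W S by (intro expectation_Max_deviation_le) auto
  finally have "?n * (mean_payoff P y - samples.expectation (\<lambda>F. mean_payoff P (?z F)))
      \<le> sqrt (?n * ln (card S) / 2)"
    using S by (simp add: integrable_mean_payoff_leader samples.prob_space)
  also have "sqrt (?n * ln (card S) / 2) = sqrt (?n\<^sup>2 * (ln (card S) / (2 * ?n)))"
    using n by (simp add: power2_eq_square)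
  also have "\<dots> = ?n * sqrt (ln (card S) / (2 * ?n))"
    by (simp only: real_sqrt_mult) simp
  finally show ?thesis using n by simp
qed

end

locale lipschitz_payoff_distribution = payoff_distribution P
  for P :: "('a::metric_space \<Rightarrow> real) measure" +
  assumes lipschitz: "1-lipschitz_on UNIV (mean_payoff P)"
begin

lemma borel_measurable_mean_payoff [measurable]: "mean_payoff P \<in> borel_measurable borel"
  using lipschitz by (intro borel_measurable_continuous_onI lipschitz_on_continuous_on)

lemma SUP_mean_payoff_le_finite_net:
  assumes "finite_net r UNIV S"
  obtains y where "y \<in> S" "(SUP x. mean_payoff P x) \<le> mean_payoff P y + r"
proof -
  have S: "finite S" "S \<noteq> {}" using assms by (auto simp: finite_net_def)
  define y where "y = arg_max_on (mean_payoff P) S"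
  have "mean_payoff P x \<le> mean_payoff P y + r" for x
  proof -
    obtain x' where x': "x' \<in> S" "dist x x' \<le> r"
      using assms by (auto simp: finite_net_def)
    have "dist (mean_payoff P x) (mean_payoff P x') \<le> 1 * dist x x'"
      using lipschitz by (rule lipschitz_onD) auto
    moreover have "mean_payoff P x' \<le> mean_payoff P y"
      unfolding y_def using S(1) x'(1) by (rule arg_max_on_greatest)
    ultimately show ?thesis using x'(2) by (simp add: dist_real_def)
  qed
  then have "(SUP x. mean_payoff P x) \<le> mean_payoff P y + r"
    by (intro cSUP_least) auto
  moreover have "y \<in> S" unfolding y_def by (rule arg_max_on_in[OF S])
  ultimately show thesis using that by blast
qed

end

lemma lipschitz_instance_iff: "lipschitz_instance P \<longleftrightarrow> lipschitz_payoff_distribution P"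
  by (simp add: lipschitz_instance_def lipschitz_payoff_distribution_def
      lipschitz_payoff_distribution_axioms_def payoff_distribution_def
      payoff_distribution_axioms_def)

section \<open>Regret as a sum over the rounds\<close>

definition round_regret :: "'a experts_algorithm \<Rightarrow> ('a \<Rightarrow> real) measure \<Rightarrow> nat \<Rightarrow> real" where
  "round_regret A P t = (SUP x. mean_payoff P x) -
     (\<integral>(\<omega>, F). mean_payoff P (chosen A \<omega> F t) \<partial>(seed A \<Otimes>\<^sub>M payoff_sequences P))"

context lipschitz_payoff_distribution
begin

lemma integrable_mean_payoff_chosen:
  assumes "valid_algorithm A"
  shows "integrable (seed A \<Otimes>\<^sub>M payoff_sequences P)
    (\<lambda>(\<omega>, F). mean_payoff P (chosen A \<omega> F t))"
proof -
  interpret seed: prob_space "seed A" using assms by (simp add: valid_algorithm_def)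
  interpret pair_prob_space "seed A" "payoff_sequences P" ..
  have "(\<lambda>(\<omega>, F). chosen A \<omega> F t)
      \<in> borel_measurable (seed A \<Otimes>\<^sub>M payoff_sequences payoff_space)"
    using assms by (simp add: valid_algorithm_def)
  also have "borel_measurable (seed A \<Otimes>\<^sub>M payoff_sequences payoff_space)
      = borel_measurable (seed A \<Otimes>\<^sub>M payoff_sequences P)"
    by (intro measurable_cong_sets sets_pair_measure_cong sets_PiM_cong)
      (simp_all add: sets_eq_payoff_space)
  finally have [measurable]: "(\<lambda>z. chosen A (fst z) (snd z) t)
      \<in> borel_measurable (seed A \<Otimes>\<^sub>M payoff_sequences P)"
    by (simp add: case_prod_unfold)
  show ?thesis
    unfolding case_prod_unfold
    by (rule P.integrable_const_bound[where B = 1]) (use mean_payoff_bounds in auto)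
qed

lemma regret_eq_sum_round_regret:
  assumes "valid_algorithm A"
  shows "regret A P t = (\<Sum>s<t. round_regret A P s)"
proof -
  let ?Q = "seed A \<Otimes>\<^sub>M payoff_sequences P"
  have "(\<integral>(\<omega>, F). (\<Sum>s<t. mean_payoff P (chosen A \<omega> F s)) \<partial>?Q)
      = (\<Sum>s<t. \<integral>(\<omega>, F). mean_payoff P (chosen A \<omega> F s) \<partial>?Q)"
    using integrable_mean_payoff_chosen[OF assms] unfolding case_prod_unfold
    by (intro Bochner_Integration.integral_sum)
  then show ?thesis
    by (simp add: regret_def round_regret_def sum_subtractf)
qed

lemma round_regret_le_1: "round_regret A P t \<le> 1"
proof -
  have "(SUP x. mean_payoff P x) \<le> 1"
    using mean_payoff_bounds by (intro cSUP_least) auto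
  moreover have "0 \<le> (\<integral>(\<omega>, F). mean_payoff P (chosen A \<omega> F t)
      \<partial>(seed A \<Otimes>\<^sub>M payoff_sequences P))"
    using mean_payoff_bounds by (intro integral_nonneg_AE) auto
  ultimately show ?thesis by (simp add: round_regret_def)
qed

end

lemma sum_powr_le:
  fixes p :: real
  assumes "0 < p" "p < 1"
  shows "(\<Sum>s<t. (real s + 1) powr (p - 1)) \<le> real t powr p / p"
proof (induction t)
  case (Suc t)
  have "p * (real t + 1) powr (p - 1) \<le> (real t + 1) powr p - real t powr p"
  proof (cases "t = 0")
    case False
    then have "\<exists>z>real t. z < real t + 1 \<and>
        (real t + 1) powr p - real t powr p = (real t + 1 - real t) * (p * z powr (p - 1))"
      by (intro MVT2) (auto intro!: derivative_eq_intros simp: powr_diff)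
    then obtain z where z: "z > real t" "z < real t + 1"
        "(real t + 1) powr p - real t powr p = p * z powr (p - 1)" by auto
    then have "(real t + 1) powr (p - 1) \<le> z powr (p - 1)"
      using assms by (intro powr_mono2') auto
    with z(3) show ?thesis using assms by simp
  qed (use assms in simp)
  with Suc show ?case using assms by (simp add: field_simps)
qed simp

lemma sum_le_powr_if_eventually_le_powr:
  fixes g :: "nat \<Rightarrow> real" and p c :: real and t\<^sub>0 :: nat
  assumes p: "0 < p" "p < 1" and "c \<ge> 0" and le_1: "\<And>s. g s \<le> 1"
    and late: "\<And>s. s \<ge> t\<^sub>0 \<Longrightarrow> g s \<le> c * (real s + 1) powr (p - 1)"
  shows "(\<Sum>s<t. g s) \<le> (t\<^sub>0 + c / p) * real t powr p"
proof -
  have early: "(\<Sum>s<t. of_bool (s < t\<^sub>0)) \<le> t\<^sub>0 * real t powr p"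
  proof (cases "t = 0")
    case False
    have "(\<Sum>s<t. of_bool (s < t\<^sub>0) :: real) = card ({..<t} \<inter> {..<t\<^sub>0})"
      by (simp add: lessThan_def)
    also have "\<dots> \<le> t\<^sub>0"
      using card_mono[of "{..<t\<^sub>0}" "{..<t} \<inter> {..<t\<^sub>0}"] by simp
    also have "\<dots> \<le> t\<^sub>0 * real t powr p"
      using False p by (simp add: mult_le_cancel_left1 ge_one_powr_ge_zero)
    finally show ?thesis .
  qed simp
  have "g s \<le> of_bool (s < t\<^sub>0) + c * (real s + 1) powr (p - 1)" for s
    using le_1[of s] late[of s] \<open>c \<ge> 0\<close> by (cases "s < t\<^sub>0") (auto intro: add_increasing2)
  then have "(\<Sum>s<t. g s) \<le> (\<Sum>s<t. of_bool (s < t\<^sub>0) + c * (real s + 1) powr (p - 1))"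
    by (rule sum_mono)
  also have "\<dots> = (\<Sum>s<t. of_bool (s < t\<^sub>0)) + c * (\<Sum>s<t. (real s + 1) powr (p - 1))"
    by (simp only: sum.distrib sum_distrib_left)
  also have "\<dots> \<le> t\<^sub>0 * real t powr p + c * (real t powr p / p)"
    using early sum_powr_le[OF p] \<open>c \<ge> 0\<close> by (intro add_mono mult_left_mono)
  finally show ?thesis by (simp add: algebra_simps)
qed

section \<open>Following the leader of a net\<close>

primrec query_all :: "'a list \<Rightarrow> 'a query_tree" where
  "query_all [] = Stop"
| "query_all (x # xs) = Query x (\<lambda>_. query_all xs)"

lemma map_of_answers_query_all:
  "x \<in> set xs \<Longrightarrow> map_of (answers (query_all xs) f) x = Some (f x)"
  by (induction xs) auto

lemma length_history [simp]: "length (history A \<omega> F t) = t"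
  by (induction t) (auto simp: Let_def)

lemma history_nth:
  assumes "s < t"
  shows "history A \<omega> F t ! s = (let h = history A \<omega> F s; x = pick A \<omega> h; y = F s x
      in (x, y, answers (query A \<omega> h y) (F s)))"
  using assms
proof (induction t)
  case (Suc t)
  then show ?case
    by (cases "s = t") (simp_all add: Let_def nth_append)
qed simp

text \<open>Since round \<open>t\<close> ignores the rounds before \<open>t div 2\<close>, the payoff function of round \<open>s\<close> is
  consulted only up to round \<open>2 * s + 1\<close>; its query list is therefore finite although the nets get
  finer forever.\<close>

definition follow_the_leader :: "(nat \<Rightarrow> 'a list) \<Rightarrow> 'a experts_algorithm" where
  "follow_the_leader net = Experts_Algorithm (return borel 0)
     (\<lambda>_ h. empirical_leader {length h div 2..<length h} (set (net (length h)))
        (\<lambda>s x. the (map_of (snd (snd (h ! s))) x)))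
     (\<lambda>_ h _. query_all (concat (map net [0..<2 * length h + 2])))"

lemma seed_follow_the_leader: "seed (follow_the_leader net) = return borel 0"
  by (simp add: follow_the_leader_def)

lemma recorded_payoff_follow_the_leader:
  assumes "s \<in> {t div 2..<t}" "x \<in> set (net t)"
  shows "the (map_of (snd (snd (history (follow_the_leader net) \<omega> F t ! s))) x) = F s x"
proof -
  have "t < 2 * s + 2" using assms(1) by auto
  then have "x \<in> set (concat (map net [0..<2 * s + 2]))"
    using assms(2) by (auto simp del: upt_Suc)
  from map_of_answers_query_all[OF this, of "F s"] show ?thesis
    using assms(1) by (simp add: history_nth Let_def follow_the_leader_def del: upt_Suc)
qed

lemma chosen_follow_the_leader:
  "chosen (follow_the_leader net) \<omega> F t = empirical_leader {t div 2..<t} (set (net t)) F"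
proof -
  have "chosen (follow_the_leader net) \<omega> F t = empirical_leader {t div 2..<t} (set (net t))
      (\<lambda>s x. the (map_of (snd (snd (history (follow_the_leader net) \<omega> F t ! s))) x))"
    by (simp add: chosen_def follow_the_leader_def)
  also have "\<dots> = empirical_leader {t div 2..<t} (set (net t)) F"
    unfolding empirical_leader_def
    by (intro arg_max_on_cong sum.cong refl recorded_payoff_follow_the_leader)
  finally show ?thesis .
qed

lemma valid_follow_the_leader: "valid_algorithm (follow_the_leader net)"
proof -
  let ?Q = "return borel (0::real) \<Otimes>\<^sub>M payoff_sequences payoff_space"
  have "(\<lambda>z. empirical_leader {t div 2..<t} (set (net t)) (snd z))
      \<in> measurable ?Q (count_space UNIV)" for t
    by (rule measurable_empirical_leader) auto
  then have "(\<lambda>z. empirical_leader {t div 2..<t} (set (net t)) (snd z))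
      \<in> borel_measurable ?Q" for t
    by (rule measurable_compose) simp
  then show ?thesis
    unfolding valid_algorithm_def seed_follow_the_leader chosen_follow_the_leader case_prod_unfold
    by (auto intro: prob_space_return)
qed

context lipschitz_payoff_distribution
begin

lemma round_regret_follow_the_leader:
  "round_regret (follow_the_leader net) P t = (SUP x. mean_payoff P x) -
     samples.expectation (\<lambda>F. mean_payoff P (empirical_leader {t div 2..<t} (set (net t)) F))"
proof -
  let ?\<mu> = "\<lambda>F. mean_payoff P (empirical_leader {t div 2..<t} (set (net t)) F)"
  let ?Q = "payoff_sequences P"
  interpret seed: prob_space "return borel (0::real)" by (rule prob_space_return) simp
  interpret pair_prob_space "return borel (0::real)" ?Q ..
  have "integrable (return borel (0::real) \<Otimes>\<^sub>M ?Q) (\<lambda>(\<omega>, F). ?\<mu> F)"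
    using integrable_mean_payoff_chosen[OF valid_follow_the_leader, of net t]
    by (simp add: seed_follow_the_leader chosen_follow_the_leader)
  from integral_snd[OF this]
  have "(\<integral>(\<omega>, F). ?\<mu> F \<partial>(return borel (0::real) \<Otimes>\<^sub>M ?Q)) = samples.expectation ?\<mu>"
    using seed.prob_space by simp
  then show ?thesis
    by (simp add: round_regret_def seed_follow_the_leader chosen_follow_the_leader)
qed

lemma round_regret_follow_the_leader_le:
  assumes net: "finite_net r UNIV (set (net t))" and "t \<ge> 1"
  shows "round_regret (follow_the_leader net) P t \<le>
    r + sqrt (ln (card (set (net t))) / t)"
proof -
  obtain y where y: "y \<in> set (net t)" "(SUP x. mean_payoff P x) \<le> mean_payoff P y + r"
    using net by (rule SUP_mean_payoff_le_finite_net)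
  have "round_regret (follow_the_leader net) P t
      \<le> r + (mean_payoff P y - samples.expectation
          (\<lambda>F. mean_payoff P (empirical_leader {t div 2..<t} (set (net t)) F)))"
    using y(2) by (simp add: round_regret_follow_the_leader)
  also have "\<dots> \<le> r + sqrt (ln (card (set (net t))) / (2 * card {t div 2..<t}))"
    using y(1) \<open>t \<ge> 1\<close> by (intro add_left_mono expected_gap_empirical_leader_le) auto
  also have "\<dots> \<le> r + sqrt (ln (card (set (net t))) / t)"
  proof -
    have "t \<le> 2 * card {t div 2..<t}" by simp
    then show ?thesis
      using y(1) \<open>t \<ge> 1\<close>
      by (intro add_left_mono real_sqrt_le_mono divide_left_mono)
        (auto simp: card_gt_0_iff Suc_le_eq intro!: ln_ge_zero)
  qed
  finally show ?thesis .
qed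

lemma round_regret_follow_the_leader_balanced:
  assumes net: "balanced_net (real t + 1) r UNIV (set (net t))" and "t \<ge> 1" "r \<ge> 0"
  shows "round_regret (follow_the_leader net) P t \<le> 3 * r"
proof -
  have "round_regret (follow_the_leader net) P t \<le> r + sqrt (ln (card (set (net t))) / t)"
    using net \<open>t \<ge> 1\<close> by (intro round_regret_follow_the_leader_le) (auto simp: balanced_net_def)
  also have "ln (card (set (net t))) / t \<le> (real t + 1) * r\<^sup>2 / t"
    using net by (intro divide_right_mono) (auto simp: balanced_net_def)
  also have "\<dots> = (1 + 1 / t) * r\<^sup>2"
    using \<open>t \<ge> 1\<close> by (simp add: field_simps)
  also have "\<dots> \<le> 4 * r\<^sup>2"
    using \<open>t \<ge> 1\<close> by (intro mult_right_mono) (auto simp: field_simps)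
  also have "r + sqrt (4 * r\<^sup>2) = 3 * r"
    using \<open>r \<ge> 0\<close> by (simp add: real_sqrt_mult)
  finally show ?thesis by simp
qed

lemma regret_follow_the_leader_le:
  fixes p :: real
  assumes p: "0 < p" "p < 1"
    and net: "\<forall>\<^sub>F s in sequentially.
      balanced_net (real s + 1) ((real s + 1) powr (p - 1)) UNIV (set (net s))"
  obtains C where "\<And>t. regret (follow_the_leader net) P t \<le> C * real t powr p"
proof -
  have "\<forall>\<^sub>F s in sequentially.
      round_regret (follow_the_leader net) P s \<le> 3 * (real s + 1) powr (p - 1)"
    using net eventually_ge_at_top[of 1]
    by eventually_elim (auto intro: round_regret_follow_the_leader_balanced)
  then obtain t\<^sub>0 where late: "\<And>s. s \<ge> t\<^sub>0 \<Longrightarrow>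
      round_regret (follow_the_leader net) P s \<le> 3 * (real s + 1) powr (p - 1)"
    by (auto simp: eventually_sequentially)
  show thesis
  proof
    show "regret (follow_the_leader net) P t \<le> (t\<^sub>0 + 3 / p) * real t powr p" for t
      unfolding regret_eq_sum_round_regret[OF valid_follow_the_leader]
      using p _ round_regret_le_1 late by (rule sum_le_powr_if_eventually_le_powr) simp
  qed
qed

end

lemma experts_tractable_mono:
  assumes "experts_tractable TYPE('a::metric_space) p" "p \<le> \<gamma>"
  shows "experts_tractable TYPE('a) \<gamma>"
proof -
  have "C * real t powr p \<le> \<bar>C\<bar> * real t powr \<gamma>" for C t
  proof (cases "t = 0")
    case False
    then have "real t powr p \<le> real t powr \<gamma>"
      using assms(2) by (intro powr_mono) auto
    then show ?thesis by (intro mult_mono) auto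
  qed simp
  then show ?thesis
    using assms(1) unfolding experts_tractable_def by (meson order_trans)
qed

theorem theorem6p3:
  fixes d \<gamma> :: real
  assumes "\<And>x y :: 'a::metric_space. dist x y \<le> 1"
    and "log_covering_dim (UNIV :: 'a set) = ereal d"
    and "\<gamma> > (d + 1) / (d + 2)"
  shows "experts_tractable TYPE('a) \<gamma>"
proof -
  have "d \<ge> 0"
    using log_covering_dim_nonneg[of "UNIV :: 'a set"] assms(2) by simp
  then have "0 < (d + 1) / (d + 2)" "(d + 1) / (d + 2) < min \<gamma> 1"
    using assms(3) by (simp_all add: field_simps)
  then obtain p where p: "(d + 1) / (d + 2) < p" "0 < p" "p < 1" "p \<le> \<gamma>"
    using dense[of "(d + 1) / (d + 2)" "min \<gamma> 1"] by auto
  obtain net :: "nat \<Rightarrow> 'a list" where net: "\<forall>\<^sub>F s in sequentially.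
      balanced_net (real s + 1) ((real s + 1) powr (p - 1)) UNIV (set (net s))"
    using eventually_balanced_net_of_log_covering_dim[OF assms(2) p(1,3)]
    by (rule eventually_balanced_net_list)
  have "\<exists>C. \<forall>t. regret (follow_the_leader net) P t \<le> C * real t powr p"
    if "lipschitz_instance P" for P
    using that lipschitz_payoff_distribution.regret_follow_the_leader_le[OF _ p(2,3) net]
    unfolding lipschitz_instance_iff by blast
  then have "experts_tractable TYPE('a) p"
    unfolding experts_tractable_def using valid_follow_the_leader by blast
  then show ?thesis using p(4) by (rule experts_tractable_mono)
qed

end
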